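(* Suppose that $\bar x\in X$ has pointwise quadratic growth with modulus $\mu^*>0$, i.e. $f(\bar x)-f^*\ge\frac{\mu^*}{2}\operatorname{dist}^2(\bar x,X^* )$. Let $\mu>0$. For any $\Delta>0$, if there exists a $(\mu,\Delta)$ W-certificate for $f$ at $\bar x$, then $$f(\bar x)-f^*\le\max\left\{\Delta,\frac{\mu\Delta}{\mu^*}\right\}.$$ In particular, if $\mu\le\mu^*$, then $f(\bar x)-f^*\le\Delta$.
   Context: $X\subseteq\mathbb{R}^d$ is a closed convex set with Euclidean norm $\|\cdot\|$, $f:X\to\mathbb{R}$ is closed convex, $f^*=\min_Xf$, and $X^*=\arg\min_Xf$ is assumed nonempty. An affine minorant of $f$ is an affine function $h$ with $h(x)\le f(x)$ for all $x\in X$. For an affine minorant $h$, $\bar x\in X$, $\Delta>0$, define $d(h,\bar x,\Delta):=\inf\{\|\bar x-x\|:x\in X,\ h(x)\le f(\bar x)-\Delta\}$ (with $\inf\emptyset=+\infty$) and the descent-slowness $s(h,\bar x,\Delta):=d(h,\bar x,\Delta)/\Delta$. An affine function $h$ is a $(\mu,\Delta)$ W-certificate for $f$ at $\bar x\in X$ if $h$ is an affine minorant of $f$ and $s(h,\bar x,\Delta)^2\ge\frac{2}{\mu\Delta}$. *)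

theory Defs
  imports "HOL-Analysis.Analysis"
begin

definition closed_convex_fun :: "(real ^ 'd) set \<Rightarrow> (real ^ 'd \<Rightarrow> real) \<Rightarrow> bool" where
  "closed_convex_fun X f \<longleftrightarrow> convex_on X f \<and> closed (epigraph X f)"

definition argmin_set :: "'a set \<Rightarrow> ('a \<Rightarrow> real) \<Rightarrow> 'a set" where
  "argmin_set X f = {x. is_arg_min f (\<lambda>x. x \<in> X) x}"

(* The infimum is the minimum of f over X when argmin_set X f is nonempty;
   only that case is meant. *)
definition min_val :: "'a set \<Rightarrow> ('a \<Rightarrow> real) \<Rightarrow> real" where
  "min_val X f = (INF x\<in>X. f x)"

definition affine_fun :: "(real ^ 'd \<Rightarrow> real) \<Rightarrow> bool" where
  "affine_fun h \<longleftrightarrow> (\<exists>a b. \<forall>x. h x = a \<bullet> x + b)"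

definition affine_minorant :: "(real ^ 'd) set \<Rightarrow> (real ^ 'd \<Rightarrow> real) \<Rightarrow> (real ^ 'd \<Rightarrow> real) \<Rightarrow> bool" where
  "affine_minorant X f h \<longleftrightarrow> affine_fun h \<and> (\<forall>x\<in>X. h x \<le> f x)"

(* Extended-real valued: the infimum over an empty set of points is \<infinity>. *)
definition descent_dist ::
  "(real ^ 'd) set \<Rightarrow> (real ^ 'd \<Rightarrow> real) \<Rightarrow> (real ^ 'd \<Rightarrow> real) \<Rightarrow> real ^ 'd \<Rightarrow> real \<Rightarrow> ereal" where
  "descent_dist X f h xbar \<Delta> =
     (INF x\<in>{x\<in>X. h x \<le> f xbar - \<Delta>}. ereal (norm (xbar - x)))"

definition descent_slowness ::
  "(real ^ 'd) set \<Rightarrow> (real ^ 'd \<Rightarrow> real) \<Rightarrow> (real ^ 'd \<Rightarrow> real) \<Rightarrow> real ^ 'd \<Rightarrow> real \<Rightarrow> ereal" where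
  "descent_slowness X f h xbar \<Delta> = descent_dist X f h xbar \<Delta> / ereal \<Delta>"

(* Meant for xbar \<in> X, \<mu> > 0 and \<Delta> > 0. *)
definition W_certificate ::
  "(real ^ 'd) set \<Rightarrow> (real ^ 'd \<Rightarrow> real) \<Rightarrow> real \<Rightarrow> real \<Rightarrow> real ^ 'd \<Rightarrow> (real ^ 'd \<Rightarrow> real) \<Rightarrow> bool" where
  "W_certificate X f \<mu> \<Delta> xbar h \<longleftrightarrow>
     affine_minorant X f h \<and> (descent_slowness X f h xbar \<Delta>)\<^sup>2 \<ge> ereal (2 / (\<mu> * \<Delta>))"

(* Meant for nonempty argmin_set X f, where infdist is the usual distance to a set. *)
definition pointwise_quadratic_growth ::
  "(real ^ 'd) set \<Rightarrow> (real ^ 'd \<Rightarrow> real) \<Rightarrow> real \<Rightarrow> real ^ 'd \<Rightarrow> bool" where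
  "pointwise_quadratic_growth X f \<mu>s xbar \<longleftrightarrow>
     f xbar - min_val X f \<ge> \<mu>s / 2 * (infdist xbar (argmin_set X f))\<^sup>2"

end

theory Submission
  imports Defs
begin

text \<open>
  Let \<open>\<delta> = f xbar - min f\<close> and suppose \<open>\<delta> > \<Delta>\<close>. A certificate \<open>h\<close> keeps the whole level set
  \<open>{x \<in> X. h x \<le> f xbar - \<Delta>}\<close> at squared distance at least \<open>2 \<Delta> / \<mu>\<close> from \<open>xbar\<close>
  (\<open>W_certificate_dist\<close>). This level set contains a point of every segment from \<open>xbar\<close> to a
  minimizer \<open>y\<close>: the affine function \<open>h\<close> is at most \<open>f xbar\<close> at one end and at most
  \<open>f xbar - \<delta>\<close> at the other, so it is at most
  \<open>f xbar - \<Delta>\<close> at the fraction \<open>\<Delta> / \<delta>\<close> of the way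
  (\<open>affine_minorant_segment\<close>). Consequently every minimizer is at squared distance at least
  \<open>(\<delta> / \<Delta>)\<^sup>2 * (2 \<Delta> / \<mu>) = 2 \<delta>\<^sup>2 / (\<mu> \<Delta>)\<close> from \<open>xbar\<close>. Quadratic growth bounds the squared
  distance to the minimizers above by \<open>2 \<delta> / \<mu>s\<close>, and comparing the two bounds gives
  \<open>\<delta> \<le> \<mu> \<Delta> / \<mu>s\<close>.
\<close>

lemma argmin_set_iff: "x \<in> argmin_set X f \<longleftrightarrow> x \<in> X \<and> (\<forall>y\<in>X. f x \<le> f y)"
  by (auto simp: argmin_set_def is_arg_min_def not_less)

lemma min_val_eq_argmin: "x \<in> argmin_set X f \<Longrightarrow> min_val X f = f x"
  unfolding min_val_def argmin_set_iff by (intro cInf_eq_minimum) auto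

text \<open>
  A point of the level set bounds the infimum that defines the descent distance, which is
  therefore finite, and the certificate inequality can be read in the reals.
\<close>

lemma W_certificate_dist:
  assumes "W_certificate X f \<mu> \<Delta> xbar h" "\<mu> > 0" "\<Delta> > 0"
    and "x \<in> X" "h x \<le> f xbar - \<Delta>"
  shows "2 * \<Delta> / \<mu> \<le> (norm (xbar - x))\<^sup>2"
proof -
  define D where "D = descent_dist X f h xbar \<Delta>"
  have D_le: "D \<le> ereal (norm (xbar - x))"
    unfolding D_def descent_dist_def using assms by (intro INF_lower) auto
  have D_ge: "0 \<le> D"
    unfolding D_def descent_dist_def by (intro INF_greatest) auto
  obtain r where r: "D = ereal r"
    using D_le D_ge by (cases D) auto
  have "ereal (2 / (\<mu> * \<Delta>)) \<le> (D / ereal \<Delta>)\<^sup>2"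
    using assms(1) by (simp add: W_certificate_def descent_slowness_def D_def)
  then have "2 / (\<mu> * \<Delta>) \<le> (r / \<Delta>)\<^sup>2"
    using assms by (simp add: r power2_eq_square)
  then have "2 * \<Delta> / \<mu> \<le> r\<^sup>2"
    using assms by (simp add: power2_eq_square field_simps)
  also have "\<dots> \<le> (norm (xbar - x))\<^sup>2"
    using D_le D_ge by (intro power_mono) (auto simp: r)
  finally show ?thesis .
qed

lemma affine_minorant_segment:
  assumes "affine_minorant X f h" "x \<in> X" "y \<in> X" "0 \<le> t" "t \<le> 1"
  shows "h ((1 - t) *\<^sub>R x + t *\<^sub>R y) \<le> f x - t * (f x - f y)"
proof -
  obtain a b where h: "\<And>z. h z = a \<bullet> z + b"
    using assms(1) by (auto simp: affine_minorant_def affine_fun_def)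
  have "h ((1 - t) *\<^sub>R x + t *\<^sub>R y) = (1 - t) * h x + t * h y"
    by (simp add: h inner_add_right algebra_simps)
  also have "\<dots> \<le> (1 - t) * f x + t * f y"
    using assms by (intro add_mono mult_left_mono) (auto simp: affine_minorant_def)
  finally show ?thesis by (simp add: algebra_simps)
qed

text \<open>
  The certificate inequality holds at the point of the segment from \<open>xbar\<close> to \<open>y\<close> where the
  chord of \<open>f\<close>, which lies above \<open>h\<close>, has dropped by \<open>\<Delta>\<close>; scaling that point back to \<open>y\<close> multiplies the distance
  from \<open>xbar\<close> by \<open>(f xbar - f y) / \<Delta>\<close>.
\<close>

lemma W_certificate_dist_scaled:
  assumes cert: "W_certificate X f \<mu> \<Delta> xbar h" and "\<mu> > 0" "\<Delta> > 0"
    and "convex X" "xbar \<in> X" "y \<in> X" and gap: "\<Delta> \<le> f xbar - f y"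
  shows "2 * (f xbar - f y)\<^sup>2 / (\<mu> * \<Delta>) \<le> (norm (xbar - y))\<^sup>2"
proof -
  define \<delta> where "\<delta> = f xbar - f y"
  define t where "t = \<Delta> / \<delta>"
  define x where "x = (1 - t) *\<^sub>R xbar + t *\<^sub>R y"
  have \<delta>: "\<delta> > 0" using gap assms by (simp add: \<delta>_def)
  have t: "0 \<le> t" "t \<le> 1"
    using gap \<delta> assms by (auto simp: t_def \<delta>_def)
  have "x \<in> X"
    unfolding x_def using assms t by (intro convexD) auto
  moreover have "h x \<le> f xbar - t * \<delta>"
    unfolding x_def \<delta>_def using cert assms t
    by (intro affine_minorant_segment) (auto simp: W_certificate_def)
  then have "h x \<le> f xbar - \<Delta>" using \<delta> by (simp add: t_def)
  ultimately have "2 * \<Delta> / \<mu> \<le> (norm (xbar - x))\<^sup>2"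
    using W_certificate_dist[OF cert] assms by blast
  moreover have "xbar - x = t *\<^sub>R (xbar - y)"
    by (simp add: x_def algebra_simps)
  ultimately have "2 * \<Delta> / \<mu> \<le> (\<Delta> / \<delta>)\<^sup>2 * (norm (xbar - y))\<^sup>2"
    by (simp add: power_mult_distrib power_divide t_def)
  then have "2 * \<delta>\<^sup>2 / (\<mu> * \<Delta>) \<le> (norm (xbar - y))\<^sup>2"
    using \<delta> assms by (simp add: power2_eq_square field_simps)
  then show ?thesis by (simp add: \<delta>_def)
qed

theorem corollary2p5:
  fixes X :: "(real ^ 'd) set" and f :: "real ^ 'd \<Rightarrow> real" and xbar :: "real ^ 'd"
    and \<mu>s \<mu> \<Delta> :: real
  assumes "closed X" and "convex X"
    and "closed_convex_fun X f"
    and "argmin_set X f \<noteq> {}"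
    and "xbar \<in> X"
    and "\<mu>s > 0"
    and "pointwise_quadratic_growth X f \<mu>s xbar"
    and "\<mu> > 0"
    and "\<Delta> > 0"
    and "\<exists>h. W_certificate X f \<mu> \<Delta> xbar h"
  shows "f xbar - min_val X f \<le> max \<Delta> (\<mu> * \<Delta> / \<mu>s)
       \<and> (\<mu> \<le> \<mu>s \<longrightarrow> f xbar - min_val X f \<le> \<Delta>)"
proof -
  define \<delta> where "\<delta> = f xbar - min_val X f"
  obtain h where h: "W_certificate X f \<mu> \<Delta> xbar h" using assms by blast
  have main: "\<delta> \<le> \<mu> * \<Delta> / \<mu>s" if gap: "\<Delta> < \<delta>"
  proof -
    have \<delta>: "\<delta> > 0" using gap assms by simp
    have "sqrt (2 * \<delta>\<^sup>2 / (\<mu> * \<Delta>)) \<le> dist xbar y" if y: "y \<in> argmin_set X f" for y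
    proof -
      have "y \<in> X" "\<delta> = f xbar - f y"
        using y by (auto simp: \<delta>_def min_val_eq_argmin argmin_set_iff)
      then have "2 * \<delta>\<^sup>2 / (\<mu> * \<Delta>) \<le> (norm (xbar - y))\<^sup>2"
        using W_certificate_dist_scaled[OF h, of y] gap assms by simp
      then show ?thesis by (simp add: dist_norm real_le_lsqrt)
    qed
    \<comment> \<open>The bound is passed through the infimum, so that no nearest minimizer has to be chosen.\<close>
    then have "sqrt (2 * \<delta>\<^sup>2 / (\<mu> * \<Delta>)) \<le> infdist xbar (argmin_set X f)"
      unfolding infdist_notempty[OF assms(4)] using assms(4) by (intro cINF_greatest)
    then have "2 * \<delta>\<^sup>2 / (\<mu> * \<Delta>) \<le> (infdist xbar (argmin_set X f))\<^sup>2"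
      by (rule sqrt_le_D)
    then have "\<mu>s / 2 * (2 * \<delta>\<^sup>2 / (\<mu> * \<Delta>)) \<le> \<mu>s / 2 * (infdist xbar (argmin_set X f))\<^sup>2"
      using assms by (intro mult_left_mono) auto
    also have "\<dots> \<le> \<delta>"
      using assms(7) by (simp add: pointwise_quadratic_growth_def \<delta>_def)
    finally show ?thesis
      using \<delta> assms by (simp add: power2_eq_square field_simps)
  qed
  have "\<mu> * \<Delta> / \<mu>s \<le> \<Delta>" if "\<mu> \<le> \<mu>s"
    using that assms by (simp add: field_simps)
  with main show ?thesis
    unfolding \<delta>_def[symmetric] by fastforce
qed

end
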